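(* Fix an integer $t \geq 2$ and positive integers $r_1,\dots,r_t$. If $n \geq R(r_1 K_2,\dots,r_t K_2)$, then $$\tilde{R}(r_1 K_2,\dots,r_t K_2;n) \geq 3\Big(\sum_{i=1}^{t} r_i - t + 1\Big) - n.$$
   Context: For graphs $G_1,\dots,G_t$, the Ramsey number $R(G_1,\dots,G_t)$ is the smallest integer $n$ such that every colouring of the edges of $K_n$ with colours $1,\dots,t$ contains, for some $i\in\{1,\dots,t\}$, a copy of $G_i$ all of whose edges have colour $i$. Here $rK_2$ denotes the matching consisting of $r$ disjoint edges. For $n \geq R(G_1,\dots,G_t)$, the restricted online Ramsey number $\tilde{R}(G_1,\dots,G_t;n)$ is the smallest integer $k$ such that Builder can always guarantee a win within the first $k$ moves of the following game between Builder and Painter: the edges of $K_n$ are initially uncoloured; in each move Builder picks an uncoloured edge of $K_n$ and Painter colours it with one of the colours $1,\dots,t$ of her choice; Builder wins as soon as, for some $i$, there is a copy of $G_i$ all of whose edges have colour $i$. *)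

theory Defs
  imports Complex_Main "HOL-Library.Ramsey"
begin

type_synonym 'a ugraph = "'a set \<times> 'a set set"

definition ugraph :: "'a ugraph \<Rightarrow> bool" where
  "ugraph G \<longleftrightarrow> finite (fst G) \<and> snd G \<subseteq> nsets (fst G) 2"

text \<open>The host graph \<open>K\<^sub>n\<close> has vertex set \<open>{..<n}\<close>.\<close>

definition complete_edges :: "nat \<Rightarrow> nat set set" where
  "complete_edges n = nsets {..<n} 2"

text \<open>Copies are not required to be induced; isolated vertices of \<open>G\<close> must be embedded as well.\<close>

definition has_copy :: "nat \<Rightarrow> nat set set \<Rightarrow> 'a ugraph \<Rightarrow> bool" where
  "has_copy n F G \<longleftrightarrow>
     (\<exists>f. inj_on f (fst G) \<and> f ` fst G \<subseteq> {..<n} \<and> (\<forall>e \<in> snd G. f ` e \<in> F))"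

definition matching_graph :: "nat \<Rightarrow> nat ugraph" where
  "matching_graph r = ({..<2 * r}, (\<lambda>j. {2 * j, 2 * j + 1}) ` {..<r})"

definition ramsey_arrows :: "nat \<Rightarrow> nat \<Rightarrow> (nat \<Rightarrow> 'a ugraph) \<Rightarrow> bool" where
  "ramsey_arrows n t G \<longleftrightarrow>
     (\<forall>c \<in> complete_edges n \<rightarrow> {1..t}. \<exists>i \<in> {1..t}. has_copy n {e \<in> complete_edges n. c e = i} (G i))"

text \<open>A family \<open>G\<^sub>1, \<dots>, G\<^sub>t\<close> is a function \<open>G\<close> of which only the values on \<open>{1..t}\<close> matter.\<close>

definition ramsey_number :: "nat \<Rightarrow> (nat \<Rightarrow> 'a ugraph) \<Rightarrow> nat" where
  "ramsey_number t G = (LEAST n. ramsey_arrows n t G)"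

text \<open>A position of the game is a partial colouring of the edges: \<open>c e = Some i\<close> if \<open>e\<close> has been
  given colour \<open>i\<close>, and \<open>c e = None\<close> if \<open>e\<close> is still uncoloured.\<close>

definition builder_won ::
    "nat \<Rightarrow> nat \<Rightarrow> (nat \<Rightarrow> 'a ugraph) \<Rightarrow> (nat set \<rightharpoonup> nat) \<Rightarrow> bool" where
  "builder_won n t G c \<longleftrightarrow> (\<exists>i \<in> {1..t}. has_copy n {e \<in> complete_edges n. c e = Some i} (G i))"

text \<open>\<open>builder_forces n t G k c\<close>: from position \<open>c\<close>, Builder has a strategy that wins within \<open>k\<close>
  further moves against every play of Painter.\<close>

primrec builder_forces ::
    "nat \<Rightarrow> nat \<Rightarrow> (nat \<Rightarrow> 'a ugraph) \<Rightarrow> nat \<Rightarrow> (nat set \<rightharpoonup> nat) \<Rightarrow> bool" where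
  "builder_forces n t G 0 c \<longleftrightarrow> builder_won n t G c"
| "builder_forces n t G (Suc k) c \<longleftrightarrow> builder_won n t G c \<or>
     (\<exists>e \<in> complete_edges n - dom c. \<forall>i \<in> {1..t}. builder_forces n t G k (c(e \<mapsto> i)))"

definition online_ramsey :: "nat \<Rightarrow> (nat \<Rightarrow> 'a ugraph) \<Rightarrow> nat \<Rightarrow> nat" where
  "online_ramsey t G n = (LEAST k. builder_forces n t G k Map.empty)"


text \<open>Both minima range over nonempty sets, so \<open>LEAST\<close> is meaningful: the first by Ramsey's
  theorem, the second because Builder can pick all edges of \<open>K\<^sub>n\<close> once \<open>n\<close> is at least the Ramsey
  number.\<close>

lemma ugraph_matching_graph: "ugraph (matching_graph r)"
  by (auto simp: ugraph_def matching_graph_def)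

lemma finite_complete_edges: "finite (complete_edges n)"
  by (simp add: complete_edges_def finite_imp_finite_nsets)

lemma has_copy_mono:
  assumes "has_copy m F G" "m \<le> n" "F \<subseteq> F'"
  shows "has_copy n F' G"
proof -
  obtain f where f: "inj_on f (fst G)" "f ` fst G \<subseteq> {..<m}" "\<forall>e \<in> snd G. f ` e \<in> F"
    using assms(1) unfolding has_copy_def by blast
  have "f ` fst G \<subseteq> {..<n}"
    using f(2) assms(2) by (metis lessThan_subset_iff order_trans)
  moreover have "\<forall>e \<in> snd G. f ` e \<in> F'"
    using f(3) assms(3) by (meson subsetD)
  ultimately show ?thesis
    unfolding has_copy_def using f(1) by (intro exI[of _ f] conjI)
qed

lemma ramsey_arrows_mono:
  assumes "ramsey_arrows m t G" "m \<le> n"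
  shows "ramsey_arrows n t G"
  unfolding ramsey_arrows_def
proof
  fix c assume c: "c \<in> complete_edges n \<rightarrow> {1..t}"
  have sub: "complete_edges m \<subseteq> complete_edges n"
    unfolding complete_edges_def using assms(2) by (intro nsets_mono) auto
  then have "c \<in> complete_edges m \<rightarrow> {1..t}" using c by auto
  then obtain i where "i \<in> {1..t}" "has_copy m {e \<in> complete_edges m. c e = i} (G i)"
    using assms(1) unfolding ramsey_arrows_def by blast
  then show "\<exists>i\<in>{1..t}. has_copy n {e \<in> complete_edges n. c e = i} (G i)"
    using has_copy_mono[OF _ assms(2), of _ "G i" "{e \<in> complete_edges n. c e = i}"] sub by blast
qed

lemma ex_ramsey_arrows:
  assumes "\<And>i. i \<in> {1..t} \<Longrightarrow> ugraph (G i)"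
  shows "\<exists>n. ramsey_arrows n t G"
proof -
  define qs where "qs = map (\<lambda>i. card (fst (G (Suc i)))) [0..<t]"
  obtain N :: nat where N: "partn_lst {..<N} qs 2"
    using ramsey_full by blast
  have "ramsey_arrows N t G"
    unfolding ramsey_arrows_def
  proof
    fix c assume c: "c \<in> complete_edges N \<rightarrow> {1..t}"
    have "(\<lambda>e. c e - 1) \<in> nsets {..<N} 2 \<rightarrow> {..<length qs}"
    proof
      fix e :: "nat set" assume "e \<in> nsets {..<N} 2"
      then have "c e \<in> {1..t}" using c by (auto simp: complete_edges_def)
      then show "c e - 1 \<in> {..<length qs}" by (auto simp: qs_def)
    qed
    then obtain i H where i: "i < length qs" and H: "H \<in> nsets {..<N} (qs ! i)"
      and mono: "(\<lambda>e. c e - 1) ` nsets H 2 \<subseteq> {i}"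
      using N unfolding partn_lst_def monochromatic_def by blast
    have it: "Suc i \<in> {1..t}" using i by (auto simp: qs_def)
    have ug: "finite (fst (G (Suc i)))" "snd (G (Suc i)) \<subseteq> nsets (fst (G (Suc i))) 2"
      using assms[OF it] by (auto simp: ugraph_def)
    have HN: "H \<subseteq> {..<N}" "finite H" "card H = card (fst (G (Suc i)))"
      using H i by (auto simp: nsets_def qs_def)
    obtain f where f: "bij_betw f (fst (G (Suc i))) H"
      using finite_same_card_bij[OF ug(1) HN(2)] HN(3) by auto
    have inj: "inj_on f (fst (G (Suc i)))" and im: "f ` fst (G (Suc i)) = H"
      using f by (auto simp: bij_betw_def)
    have "f ` e \<in> {e \<in> complete_edges N. c e = Suc i}" if e: "e \<in> snd (G (Suc i))" for e
    proof -
      have e2: "e \<subseteq> fst (G (Suc i))" "finite e" "card e = 2"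
        using e ug(2) by (auto simp: nsets_def)
      have "card (f ` e) = 2" using e2 inj by (metis card_image inj_on_subset)
      then have fH: "f ` e \<in> nsets H 2" using e2 im by (auto simp: nsets_def)
      then have fN: "f ` e \<in> complete_edges N"
        using HN(1) by (auto simp: complete_edges_def nsets_def)
      then have "c (f ` e) \<in> {1..t}" using c by auto
      moreover have "c (f ` e) - 1 = i" using mono fH by blast
      ultimately show ?thesis using fN by auto
    qed
    then have "has_copy N {e \<in> complete_edges N. c e = Suc i} (G (Suc i))"
      unfolding has_copy_def using inj im HN(1) by blast
    then show "\<exists>i\<in>{1..t}. has_copy N {e \<in> complete_edges N. c e = i} (G i)"
      using it by blast
  qed
  then show ?thesis ..
qed

lemma ramsey_arrows_iff:
  assumes "\<And>i. i \<in> {1..t} \<Longrightarrow> ugraph (G i)"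
  shows "ramsey_arrows n t G \<longleftrightarrow> ramsey_number t G \<le> n"
proof
  show "ramsey_arrows n t G \<Longrightarrow> ramsey_number t G \<le> n"
    unfolding ramsey_number_def by (rule Least_le)
next
  assume "ramsey_number t G \<le> n"
  moreover have "ramsey_arrows (ramsey_number t G) t G"
    unfolding ramsey_number_def
    by (rule LeastI_ex[where P = "\<lambda>n. ramsey_arrows n t G"], rule ex_ramsey_arrows, rule assms)
  ultimately show "ramsey_arrows n t G" by (rule ramsey_arrows_mono[rotated])
qed

lemma builder_won_total:
  assumes "ramsey_arrows n t G" "complete_edges n \<subseteq> dom c" "ran c \<subseteq> {1..t}"
  shows "builder_won n t G c"
proof -
  have the_c: "c e = Some (the (c e))" if "e \<in> complete_edges n" for e
    using assms(2) that by (metis domIff option.collapse subsetD)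
  have "(\<lambda>e. the (c e)) \<in> complete_edges n \<rightarrow> {1..t}"
    using the_c assms(3) by (metis (no_types, lifting) Pi_I ranI subsetD)
  from bspec[OF assms(1)[unfolded ramsey_arrows_def] this]
  obtain i where i: "i \<in> {1..t}" "has_copy n {e \<in> complete_edges n. the (c e) = i} (G i)"
    by (elim bexE)
  have "{e \<in> complete_edges n. the (c e) = i} \<subseteq> {e \<in> complete_edges n. c e = Some i}"
  proof
    fix e assume "e \<in> {e \<in> complete_edges n. the (c e) = i}"
    then show "e \<in> {e \<in> complete_edges n. c e = Some i}" using the_c[of e] by simp
  qed
  then have "has_copy n {e \<in> complete_edges n. c e = Some i} (G i)"
    by (rule has_copy_mono[OF i(2) order_refl])
  then show ?thesis
    unfolding builder_won_def using i(1) by blast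
qed

lemma builder_forces_all_edges:
  assumes "ramsey_arrows n t G" "ran c \<subseteq> {1..t}" "card (complete_edges n - dom c) \<le> k"
  shows "builder_forces n t G k c"
  using assms(2,3)
proof (induction k arbitrary: c)
  case 0
  then have "complete_edges n \<subseteq> dom c" using finite_complete_edges[of n] by simp
  then show ?case using builder_won_total[OF assms(1)] 0 by simp
next
  case (Suc k)
  show ?case
  proof (cases "complete_edges n \<subseteq> dom c")
    case True
    then show ?thesis using builder_won_total[OF assms(1)] Suc.prems(1) by simp
  next
    case False
    then obtain e where e: "e \<in> complete_edges n - dom c" by blast
    have "builder_forces n t G k (c(e \<mapsto> i))" if "i \<in> {1..t}" for i
    proof (rule Suc.IH)
      have "c e = None" using e by (simp add: domIff)
      then show "ran (c(e \<mapsto> i)) \<subseteq> {1..t}" using that Suc.prems(1) by simp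
      have "complete_edges n - dom (c(e \<mapsto> i)) = (complete_edges n - dom c) - {e}" by auto
      then show "card (complete_edges n - dom (c(e \<mapsto> i))) \<le> k"
        using e Suc.prems(2) finite_complete_edges[of n] by (simp only: card_Diff_singleton)
    qed
    then show ?thesis
      unfolding builder_forces.simps using e by (intro disjI2 bexI[of _ e] ballI)
  qed
qed

lemma builder_forces_online_ramsey:
  assumes "\<And>i. i \<in> {1..t} \<Longrightarrow> ugraph (G i)" "ramsey_number t G \<le> n"
  shows "builder_forces n t G (online_ramsey t G n) Map.empty"
proof -
  have "ramsey_arrows n t G"
    using ramsey_arrows_iff[of t G n] assms by blast
  then have "builder_forces n t G (card (complete_edges n)) Map.empty"
    by (rule builder_forces_all_edges) auto
  then show ?thesis unfolding online_ramsey_def by (rule LeastI)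
qed

end

theory Submission
  imports Defs "HOL-Library.Disjoint_Sets"
begin

text \<open>Painter keeps, for every colour \<open>i\<close>, fewer than \<open>r i\<close> blocks such that each edge of
  colour \<open>i\<close> contains one of them; all blocks are pairwise disjoint and consist of one vertex (the
  centre of a star) or of two vertices (an isolated edge). An edge containing a block gets the
  colour of that block. An edge that only meets a two-vertex block turns this block into a star
  centred at the common vertex. Only an edge disjoint from all blocks becomes a new block. A star
  costs one vertex and at least two edges, an isolated edge two vertices and one edge, so after
  \<open>j\<close> moves there are at most \<open>(n + j) / 3\<close> blocks, and Painter does not run out of colours while
  \<open>n + j < 3 (\<Sum>i. r i - 1) + 3\<close>. This is an online form of the bound \<open>(n + j) / 3\<close> for the
  vertex cover number.\<close>

text \<open>\<open>3 - card s\<close> is the number of moves charged to a block: one for an isolated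
  edge, two for a star. \<open>j\<close> stands for the moves made so far and \<open>h\<close> for
  the colours of the blocks.\<close>

definition block_cover ::
    "nat \<Rightarrow> nat \<Rightarrow> nat set set \<Rightarrow> (nat set \<Rightarrow> nat) \<Rightarrow> (nat set \<rightharpoonup> nat) \<Rightarrow> bool" where
  "block_cover n j U h c \<longleftrightarrow>
     U \<subseteq> Pow {..<n} \<and> disjoint U \<and> (\<forall>s\<in>U. s \<noteq> {} \<and> card s \<le> 2) \<and>
     (\<Sum>s\<in>U. 3 - card s) \<le> j \<and>
     (\<forall>e i. c e = Some i \<longrightarrow> (\<exists>s\<in>U. s \<subseteq> e \<and> h s = i))"

definition within_budget ::
    "nat \<Rightarrow> (nat \<Rightarrow> nat) \<Rightarrow> nat set set \<Rightarrow> (nat set \<Rightarrow> nat) \<Rightarrow> bool" where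
  "within_budget t r U h \<longleftrightarrow>
     h ` U \<subseteq> {1..t} \<and> (\<forall>i\<in>{1..t}. card {s\<in>U. h s = i} < r i)"

lemma block_cover_finite:
  assumes "block_cover n j U h c"
  shows "finite U"
  using assms unfolding block_cover_def by (meson finite_Pow_iff finite_lessThan finite_subset)

text \<open>Each block accounts for \<open>card s\<close> vertices and \<open>3 - card s\<close>
  moves, three units in all; disjointness keeps the vertices within \<open>n\<close>.\<close>

lemma block_cover_card:
  assumes "block_cover n j U h c"
  shows "3 * card U \<le> n + j"
proof -
  have U: "U \<subseteq> Pow {..<n}" "disjoint U" "\<forall>s\<in>U. card s \<le> 2" "(\<Sum>s\<in>U. 3 - card s) \<le> j"
    using assms by (auto simp: block_cover_def)
  have "(\<Sum>s\<in>U. card s) = card (\<Union>U)"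
    using U(1,2) by (intro card_Union_disjoint[symmetric]) (auto intro: finite_subset)
  also have "\<dots> \<le> n"
    using U(1) card_mono[of "{..<n}" "\<Union>U"] by auto
  finally have "(\<Sum>s\<in>U. card s) \<le> n" .
  moreover have "3 * card U = (\<Sum>s\<in>U. card s + (3 - card s))"
  proof -
    have "(\<Sum>s\<in>U. card s + (3 - card s)) = (\<Sum>s\<in>U. 3)"
      using U(3) by (intro sum.cong) auto
    then show ?thesis by simp
  qed
  ultimately show ?thesis using U(4) by (simp add: sum.distrib)
qed

text \<open>Disjoint edges of colour \<open>i\<close> contain distinct blocks of colour
  \<open>i\<close>, as blocks are nonempty; the budget has fewer than \<open>r i\<close> of
  these.\<close>

lemma block_cover_not_builder_won:
  assumes "block_cover n j U h c" "within_budget t r U h"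
  shows "\<not> builder_won n t (\<lambda>i. matching_graph (r i)) c"
proof
  assume "builder_won n t (\<lambda>i. matching_graph (r i)) c"
  then obtain i f where i: "i \<in> {1..t}" and inj: "inj_on f {..<2 * r i}"
    and "\<forall>a<r i. c (f ` {2 * a, 2 * a + 1}) = Some i"
    unfolding builder_won_def has_copy_def matching_graph_def by auto
  then have "\<forall>a<r i. \<exists>s\<in>U. s \<subseteq> f ` {2 * a, 2 * a + 1} \<and> h s = i"
    using assms(1) unfolding block_cover_def by blast
  then obtain g where g: "\<And>a. a < r i \<Longrightarrow> g a \<in> U \<and> g a \<subseteq> f ` {2 * a, 2 * a + 1} \<and> h (g a) = i"
    by metis
  have "inj_on g {..<r i}"
  proof (rule inj_onI, rule ccontr)
    fix a b assume ab: "a \<in> {..<r i}" "b \<in> {..<r i}" "g a = g b" "a \<noteq> b"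
    obtain x where "x \<in> g a" using g[of a] ab assms(1) unfolding block_cover_def by blast
    then have x: "x \<in> f ` {2 * a, 2 * a + 1}" "x \<in> f ` {2 * b, 2 * b + 1}"
      using g[of a] g[of b] ab by auto
    have "f ` {2 * a, 2 * a + 1} \<inter> f ` {2 * b, 2 * b + 1} =
        f ` ({2 * a, 2 * a + 1} \<inter> {2 * b, 2 * b + 1})"
      using ab by (intro inj_on_image_Int[OF inj, symmetric]) auto
    also have "{2 * a, 2 * a + 1} \<inter> {2 * b, 2 * b + 1} = {}" using ab(4) by auto
    finally show False using x by blast
  qed
  then have "r i \<le> card {s\<in>U. h s = i}"
    using g card_inj_on_le[of g "{..<r i}" "{s\<in>U. h s = i}"] block_cover_finite[OF assms(1)]
    by auto
  then show False using assms(2) i unfolding within_budget_def by fastforce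
qed

text \<open>Used in contrapositive form: with fewer blocks than the sum, some colour can take one
  more block and stay below \<open>r i\<close>.\<close>

lemma sum_pred_le_card:
  assumes "finite U" "h ` U \<subseteq> {1..t::nat}" "\<And>i. i \<in> {1..t} \<Longrightarrow> r i - 1 \<le> card {s\<in>U. h s = i}"
  shows "(\<Sum>i = 1..t. r i - 1) \<le> card U"
proof -
  have "(\<Sum>i = 1..t. r i - 1) \<le> (\<Sum>i = 1..t. card {s\<in>U. h s = i})"
    by (intro sum_mono assms(3))
  also have "\<dots> = card U"
    using sum.group[OF assms(1) _ assms(2), of "\<lambda>_. 1::nat"] by simp
  finally show ?thesis .
qed

lemma painter_step:
  assumes cover: "block_cover n j U h c" and budget: "within_budget t r U h"
    and e: "e \<in> complete_edges n - dom c"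
    and moves: "n + Suc j < 3 * (\<Sum>i = 1..t. r i - 1) + 3"
  obtains U' h' i where "i \<in> {1..t}" "block_cover n (Suc j) U' h' (c(e \<mapsto> i))"
    "within_budget t r U' h'"
proof -
  have U: "U \<subseteq> Pow {..<n}" "disjoint U" "\<And>s. s \<in> U \<Longrightarrow> s \<noteq> {} \<and> card s \<le> 2"
    "(\<Sum>s\<in>U. 3 - card s) \<le> j" "\<And>e i. c e = Some i \<Longrightarrow> \<exists>s\<in>U. s \<subseteq> e \<and> h s = i"
    using cover by (auto simp: block_cover_def)
  have hU: "h ` U \<subseteq> {1..t}" "\<And>i. i \<in> {1..t} \<Longrightarrow> card {s\<in>U. h s = i} < r i"
    using budget by (auto simp: within_budget_def)
  have fin: "finite U" by (rule block_cover_finite[OF cover])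
  have en: "e \<subseteq> {..<n}" "finite e" "card e = 2"
    using e by (auto simp: complete_edges_def nsets_def)
  consider (inside) s where "s \<in> U" "s \<subseteq> e"
    | (meets) s where "s \<in> U" "s \<inter> e \<noteq> {}" "\<not> s \<subseteq> e"
    | (fresh) "\<forall>s\<in>U. s \<inter> e = {}"
    by blast
  then show ?thesis
  proof cases
    case inside
    \<comment> \<open>No block changes; the move goes uncharged.\<close>
    have "block_cover n (Suc j) U h (c(e \<mapsto> h s))"
      unfolding block_cover_def using U inside by auto
    then show ?thesis using that[of "h s" U h] inside hU budget by blast
  next
    case meets
    define s' where "s' = s \<inter> e"
    define U' where "U' = insert s' (U - {s})"
    define h' where "h' = h(s' := h s)"
    have sfin: "finite s" using U(1) meets(1) finite_subset by blast
    have s': "s' \<noteq> {}" "s' \<subset> s" "s' \<subseteq> e" using meets by (auto simp: s'_def)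
    have "card s' < card s" using s'(2) sfin by (rule psubset_card_mono[rotated])
    moreover have "card s' \<noteq> 0" using s'(1,2) sfin finite_subset by fastforce
    ultimately have cards: "card s' = 1" "card s = 2" using U(3)[OF meets(1)] by auto
    have dis: "s' \<inter> u = {}" if "u \<in> U - {s}" for u
      using disjointD[OF U(2) meets(1), of u] that s'(2) by auto
    \<comment> \<open>A block \<open>s'\<close> of \<open>U\<close> would differ from
      \<open>s\<close>, hence be disjoint from itself by \<open>dis\<close>. So \<open>h'\<close>
      recolours no old block.\<close>
    have new: "s' \<notin> U"
      using dis[of s'] s' by auto
    have "disjoint U'"
      unfolding U'_def using U(2) dis by (simp add: pairwise_insert disjnt_def Int_commute pairwise_subset)
    moreover have "(\<Sum>u\<in>U'. 3 - card u) \<le> Suc j"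
    \<comment> \<open>Shrinking \<open>s\<close> to a single vertex raises its charge from 1 to 2,
      which the new move pays for.\<close>
    proof -
      have "(\<Sum>u\<in>U'. 3 - card u) = 2 + (\<Sum>u\<in>U - {s}. 3 - card u)"
        unfolding U'_def using fin new cards by simp
      moreover have "(\<Sum>u\<in>U. 3 - card u) = 1 + (\<Sum>u\<in>U - {s}. 3 - card u)"
        using sum.remove[OF fin meets(1), of "\<lambda>u. 3 - card u"] cards by simp
      ultimately show ?thesis using U(4) by linarith
    qed
    moreover have "\<exists>u\<in>U'. u \<subseteq> x \<and> h' u = k" if "(c(e \<mapsto> h s)) x = Some k" for x k
    proof (cases "x = e")
      case True
      then show ?thesis using that s' by (auto simp: U'_def h'_def)
    next
      case False
      then have "c x = Some k" using that by simp
      then obtain u where u: "u \<in> U" "u \<subseteq> x" "h u = k" using U(5) by blast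
      show ?thesis
      proof (cases "u = s")
        case True
        \<comment> \<open>Edges that contained \<open>s\<close> still contain the smaller
          \<open>s'\<close>.\<close>
        then show ?thesis using u s' by (intro bexI[of _ s']) (auto simp: U'_def h'_def)
      next
        case False
        then show ?thesis using u new by (intro bexI[of _ u]) (auto simp: U'_def h'_def)
      qed
    qed
    moreover have "U' \<subseteq> Pow {..<n}" "\<forall>u\<in>U'. u \<noteq> {} \<and> card u \<le> 2"
      using U(1,3) en(1) s'(1,3) cards by (auto simp: U'_def)
    ultimately have "block_cover n (Suc j) U' h' (c(e \<mapsto> h s))"
      unfolding block_cover_def by blast
    moreover have "within_budget t r U' h'"
      unfolding within_budget_def
    proof (intro conjI ballI)
      show "h' ` U' \<subseteq> {1..t}" using hU(1) meets(1) by (auto simp: U'_def h'_def)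
    next
      fix k assume k: "k \<in> {1..t}"
      \<comment> \<open>Replacing \<open>s\<close> by \<open>s'\<close> keeps its colour, so no
        colour class of blocks grows.\<close>
      have sub: "{u\<in>U'. h' u = k} \<subseteq> (\<lambda>u. if u = s then s' else u) ` {u\<in>U. h u = k}"
        using meets(1) new by (auto simp: U'_def h'_def image_iff split: if_splits)
      have "card {u\<in>U'. h' u = k} \<le> card {u\<in>U. h u = k}"
        using fin by (intro surj_card_le[OF _ sub]) simp
      then show "card {u\<in>U'. h' u = k} < r k" using hU(2)[OF k] by simp
    qed
    moreover have "h s \<in> {1..t}" using hU(1) meets(1) by auto
    ultimately show ?thesis using that by blast
  next
    case fresh
    have new: "e \<notin> U" using fresh en(3) by auto
    \<comment> \<open>Proved for every \<open>i\<close>: the size bound that this cover yields is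
      what shows that a colour with room exists.\<close>
    have cover': "block_cover n (Suc j) (insert e U) (h(e := i)) (c(e \<mapsto> i))" for i
    proof -
      have "disjoint (insert e U)"
        using U(2) fresh by (simp add: pairwise_insert disjnt_def Int_commute)
      moreover have "(\<Sum>u\<in>insert e U. 3 - card u) \<le> Suc j" using fin new en U(4) by simp
      moreover have "\<exists>u\<in>insert e U. u \<subseteq> x \<and> (h(e := i)) u = k"
        if "(c(e \<mapsto> i)) x = Some k" for x k
        using that U(5)[of x k] new by (cases "x = e") auto
      moreover have "\<forall>u\<in>insert e U. u \<noteq> {} \<and> card u \<le> 2" using U(3) en by auto
      ultimately show ?thesis unfolding block_cover_def using U(1) en(1) by blast
    qed
    have "card U < (\<Sum>i = 1..t. r i - 1)"
      using block_cover_card[OF cover'] moves fin new by simp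
    then obtain i where i: "i \<in> {1..t}" "card {s\<in>U. h s = i} < r i - 1"
      using sum_pred_le_card[OF fin hU(1), of r] by (meson linorder_not_less)
    have "within_budget t r (insert e U) (h(e := i))"
      unfolding within_budget_def
    proof (intro conjI ballI)
      show "(h(e := i)) ` insert e U \<subseteq> {1..t}" using hU(1) i(1) by auto
    next
      fix k assume k: "k \<in> {1..t}"
      have "{u\<in>insert e U. (h(e := i)) u = k} =
          (if k = i then insert e {u\<in>U. h u = k} else {u\<in>U. h u = k})"
        using new by auto
      then show "card {u\<in>insert e U. (h(e := i)) u = k} < r k"
        using i(2) hU(2)[OF k] fin new by auto
    qed
    then show ?thesis using that i(1) cover' by blast
  qed
qed

text \<open>Each answer by \<open>painter_step\<close> moves one unit from \<open>k\<close> to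
  \<open>j\<close>, so the bound on \<open>n + j + k\<close> survives until no moves remain.\<close>

lemma block_cover_not_builder_forces:
  assumes "block_cover n j U h c" "within_budget t r U h"
    and "n + j + k < 3 * (\<Sum>i = 1..t. r i - 1) + 3"
  shows "\<not> builder_forces n t (\<lambda>i. matching_graph (r i)) k c"
  using assms
proof (induction k arbitrary: j U h c)
  case 0
  then show ?case using block_cover_not_builder_won by simp
next
  case (Suc k)
  have "\<exists>i\<in>{1..t}. \<not> builder_forces n t (\<lambda>i. matching_graph (r i)) k (c(e \<mapsto> i))"
    if e: "e \<in> complete_edges n - dom c" for e
  proof -
    have "n + Suc j < 3 * (\<Sum>i = 1..t. r i - 1) + 3" using Suc.prems(3) by linarith
    then obtain U' h' i where "i \<in> {1..t}" "block_cover n (Suc j) U' h' (c(e \<mapsto> i))"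
      "within_budget t r U' h'"
      by (rule painter_step[OF Suc.prems(1,2) e])
    moreover have "n + Suc j + k < 3 * (\<Sum>i = 1..t. r i - 1) + 3"
      using Suc.prems(3) by linarith
    ultimately show ?thesis using Suc.IH by blast
  qed
  then show ?case using block_cover_not_builder_won[OF Suc.prems(1,2)] by auto
qed

theorem theorem3:
  fixes t n :: nat and r :: "nat \<Rightarrow> nat"
  assumes "t \<ge> 2"
    and "\<And>i. i \<in> {1..t} \<Longrightarrow> r i > 0"
    and "n \<ge> ramsey_number t (\<lambda>i. matching_graph (r i))"
  shows "int (online_ramsey t (\<lambda>i. matching_graph (r i)) n)
           \<ge> 3 * ((\<Sum>i = 1..t. int (r i)) - int t + 1) - int n"
proof -
  let ?k = "online_ramsey t (\<lambda>i. matching_graph (r i)) n"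
  define m where "m = (\<Sum>i = 1..t. r i - 1)"
  \<comment> \<open>With no blocks yet, the colour 0 is a dummy, and positivity of each
    \<open>r i\<close> gives the strict budget.\<close>
  have "block_cover n 0 {} (\<lambda>_. 0) Map.empty" by (simp add: block_cover_def)
  moreover have "within_budget t r {} (\<lambda>_. 0)" using assms(2) by (auto simp: within_budget_def)
  moreover have "builder_forces n t (\<lambda>i. matching_graph (r i)) ?k Map.empty"
    using ugraph_matching_graph assms(3) by (intro builder_forces_online_ramsey)
  ultimately have bound: "\<not> n + 0 + ?k < 3 * m + 3"
    unfolding m_def using block_cover_not_builder_forces by blast
  \<comment> \<open>Positivity of \<open>r i\<close> makes the truncated \<open>r i - 1\<close>
    agree with integer subtraction.\<close>
  have m: "(\<Sum>i = 1..t. int (r i)) - int t = int m"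
  proof -
    have "int m = (\<Sum>i = 1..t. int (r i) - 1)"
      unfolding m_def of_nat_sum using assms(2)
      by (intro sum.cong) (auto simp: of_nat_diff Suc_leI)
    then show ?thesis by (simp add: sum_subtractf)
  qed
  show ?thesis unfolding m using bound by simp
qed

end
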